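(* Let $f\colon\mathbb{R}^d\to\mathbb{R}$ be a piecewise affine function such that $S(f)=\{x\in\mathbb{R}^d\mid f(x)\le 0\}$ is nonempty. Then $f$ has an error bound on every bounded subset of $\mathbb{R}^d$, that is, for every bounded set $V\subset\mathbb{R}^d$ there exists $\tau>0$ such that $\tau\operatorname{dist}(x,S(f))\le\max\{f(x),0\}$ for all $x\in V$.
   Context: $\mathbb{R}^d$ is equipped with an arbitrary norm $\|\cdot\|$; $\operatorname{dist}(x,Q)=\inf_{y\in Q}\|x-y\|$. A set is polyhedral if it is the intersection of finitely many closed half-spaces. A function $f\colon\mathbb{R}^d\to\mathbb{R}$ is piecewise affine if there are finitely many polyhedral sets $Q_1,\ldots,Q_s$ with nonempty, pairwise disjoint interiors covering $\mathbb{R}^d$ and affine functions $F_1,\ldots,F_s$ such that $f=F_k$ on $Q_k$ for each $k$. Equivalently (a known theorem of Gorokhovik and Zorko), $f(x)=\min_{i\in I}\max_{j\in J(i)}(a_{ij}+\langle v_{ij},x\rangle)$ for some finite index sets $I$, $J(i)$ and some $a_{ij}\in\mathbb{R}$, $v_{ij}\in\mathbb{R}^d$. *)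

theory Defs
  imports "HOL-Analysis.Analysis"
begin

definition is_norm :: "('a::real_vector \<Rightarrow> real) \<Rightarrow> bool" where
  "is_norm N \<longleftrightarrow>
     (\<forall>x. 0 \<le> N x) \<and>
     (\<forall>x. N x = 0 \<longleftrightarrow> x = 0) \<and>
     (\<forall>c x. N (c *\<^sub>R x) = \<bar>c\<bar> * N x) \<and>
     (\<forall>x y. N (x + y) \<le> N x + N y)"

definition norm_bounded :: "('a::real_vector \<Rightarrow> real) \<Rightarrow> 'a set \<Rightarrow> bool" where
  "norm_bounded N V \<longleftrightarrow> (\<exists>B. \<forall>x\<in>V. N x \<le> B)"

text \<open>The library's distance to a set is tied to the Euclidean norm; this is the one
  for an arbitrary norm. Only meaningful for nonempty sets.\<close>

definition dist_to_set :: "('a::real_vector \<Rightarrow> real) \<Rightarrow> 'a \<Rightarrow> 'a set \<Rightarrow> real" where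
  "dist_to_set N x Q = (INF y\<in>Q. N (x - y))"

definition affine_fun :: "('a::real_inner \<Rightarrow> real) \<Rightarrow> bool" where
  "affine_fun F \<longleftrightarrow> (\<exists>a v. \<forall>x. F x = a + v \<bullet> x)"

text \<open>It is the pieces themselves, not their interiors, that cover the space. All norms on a
  finite-dimensional space induce the same topology, so \<^const>\<open>interior\<close>
  does not depend on the chosen norm.\<close>

definition piecewise_affine :: "('a::euclidean_space \<Rightarrow> real) \<Rightarrow> bool" where
  "piecewise_affine f \<longleftrightarrow>
     (\<exists>(s::nat) Q F.
        (\<forall>k\<in>{1..s}. polyhedron (Q k) \<and> interior (Q k) \<noteq> {}) \<and>
        disjoint_family_on (\<lambda>k. interior (Q k)) {1..s} \<and>
        (\<Union>k\<in>{1..s}. Q k) = UNIV \<and>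
        (\<forall>k\<in>{1..s}. affine_fun (F k) \<and> (\<forall>x\<in>Q k. f x = F k x)))"

definition nonpos_set :: "('a \<Rightarrow> real) \<Rightarrow> 'a set" where
  "nonpos_set f = {x. f x \<le> 0}"

end

theory Submission
  imports Defs
begin

text \<open>Each piece is treated separately, after cutting it with a box containing \<open>V\<close>, which
  turns it into a polytope \<open>P\<close> on which \<open>f\<close> agrees with an affine function \<open>F\<close>. If \<open>F > 0\<close> on \<open>P\<close>,
  then \<open>F\<close> is bounded away from zero by compactness and any one point of \<open>S(f)\<close> will do. If \<open>F\<close>
  is negative somewhere on \<open>P\<close>, go along the segment towards such a point. If \<open>min F = 0\<close> on \<open>P\<close>,
  the error bound holds at the finitely many vertices, and the points satisfying it with a given
  constant form a convex set.\<close>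

text \<open>Expand \<open>x\<close> in the standard basis: subadditivity and homogeneity of
  \<open>N\<close> apply termwise, and each coordinate is at most \<open>norm x\<close> in absolute
  value. This half of norm equivalence later turns Euclidean estimates into estimates for
  \<open>N\<close>.\<close>

lemma is_norm_le_norm:
  fixes N :: "'a::euclidean_space \<Rightarrow> real"
  assumes "is_norm N"
  obtains C where "C > 0" "\<And>x. N x \<le> C * norm x"
proof
  have nonneg: "\<And>x. 0 \<le> N x" and zero: "N 0 = 0"
    and scale: "\<And>c x. N (c *\<^sub>R x) = \<bar>c\<bar> * N x"
    and tri: "\<And>x y. N (x + y) \<le> N x + N y"
    using assms unfolding is_norm_def by auto
  \<comment> \<open>The summand 1 yields strict positivity from mere nonnegativity of the
    sum.\<close>
  show "(\<Sum>b\<in>Basis. N b) + 1 > 0"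
    using sum_nonneg[of Basis N] nonneg by fastforce
  have N_sum: "N (sum g A) \<le> (\<Sum>i\<in>A. N (g i))" if "finite A" for g :: "'a \<Rightarrow> 'a" and A
    using that
  proof (induction A)
    case (insert i A)
    then show ?case using tri[of "g i" "sum g A"] by simp
  qed (simp add: zero)
  fix x
  have "N x \<le> (\<Sum>b\<in>Basis. N ((x \<bullet> b) *\<^sub>R b))"
    using N_sum[of Basis "\<lambda>b. (x \<bullet> b) *\<^sub>R b"] by (simp add: euclidean_representation)
  also have "\<dots> \<le> (\<Sum>b\<in>Basis. norm x * N b)"
    by (intro sum_mono) (simp add: scale mult_right_mono nonneg Basis_le_norm)
  also have "\<dots> \<le> ((\<Sum>b\<in>Basis. N b) + 1) * norm x"
    by (simp add: distrib_right sum_distrib_right mult.commute[of "norm x"])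
  finally show "N x \<le> ((\<Sum>b\<in>Basis. N b) + 1) * norm x" .
qed

text \<open>Since \<open>N\<close> is Lipschitz for the Euclidean norm, it attains a minimum on the
  compact unit sphere; this is positive by definiteness, and homogeneity extends the bound to all
  vectors. It makes \<open>N\<close>-bounded sets bounded in the Euclidean sense.\<close>

lemma norm_le_is_norm:
  fixes N :: "'a::euclidean_space \<Rightarrow> real"
  assumes "is_norm N"
  obtains c where "c > 0" "\<And>x. c * norm x \<le> N x"
proof -
  have nonneg: "\<And>x. 0 \<le> N x" and eq0: "\<And>x. N x = 0 \<longleftrightarrow> x = 0"
    and scale: "\<And>c x. N (c *\<^sub>R x) = \<bar>c\<bar> * N x"
    and tri: "\<And>x y. N (x + y) \<le> N x + N y"
    using assms unfolding is_norm_def by auto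
  obtain C where C: "C > 0" "\<And>x. N x \<le> C * norm x"
    using is_norm_le_norm[OF assms] by blast
  have "\<bar>N x - N y\<bar> \<le> C * dist x y" for x y
  proof -
    have "N x \<le> N y + N (x - y)" "N y \<le> N x + N (y - x)"
      using tri[of y "x - y"] tri[of x "y - x"] by simp_all
    then show ?thesis
      using C(2)[of "x - y"] C(2)[of "y - x"] by (simp add: dist_norm norm_minus_commute)
  qed
  then have "C-lipschitz_on (sphere 0 1) N"
    using C(1) by (intro lipschitz_onI) (auto simp: dist_real_def)
  then have "continuous_on (sphere 0 1) N"
    by (rule lipschitz_on_continuous_on)
  then obtain u where u: "u \<in> sphere 0 1" "\<And>x. x \<in> sphere 0 1 \<Longrightarrow> N u \<le> N x"
    using continuous_attains_inf[of "sphere 0 1" N] by auto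
  show thesis
  proof
    show "N u > 0"
      using u(1) nonneg[of u] eq0[of u] by fastforce
    show "N u * norm x \<le> N x" for x
    proof (cases "x = 0")
      case False
      then have "N u \<le> N ((1 / norm x) *\<^sub>R x)"
        by (intro u(2)) simp
      then show ?thesis
        using False unfolding scale by (simp add: field_simps)
    qed (use nonneg in simp)
  qed
qed

text \<open>Walk from \<open>x\<close> towards the Slater point \<open>z\<close> until the affine
  function vanishes. The fraction of the segment covered is proportional to the value at
  \<open>x\<close>, up to a factor controlled by the value at \<open>z\<close>, and the segment is
  no longer than the diameter of \<open>P\<close>.\<close>

lemma convex_affine_error_bound_Slater:
  fixes P :: "'a::real_inner set"
  assumes "convex P" "bounded P" "z \<in> P" "a + v \<bullet> z < 0"
  obtains C where "\<And>x. x \<in> P \<Longrightarrow> a + v \<bullet> x > 0 \<Longrightarrow>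
    \<exists>y\<in>P. a + v \<bullet> y \<le> 0 \<and> norm (x - y) \<le> C * (a + v \<bullet> x)"
proof
  define F where "F x = a + v \<bullet> x" for x
  fix x assume x: "x \<in> P" "a + v \<bullet> x > 0"
  \<comment> \<open>The parameter at which \<open>F\<close> vanishes on the segment from
    \<open>x\<close> to \<open>z\<close>. Dropping \<open>F x > 0\<close> from the denominator gives
    a bound linear in \<open>F x\<close>.\<close>
  define t where "t = F x / (F x - F z)"
  have Fz: "F z < 0" and Fx: "F x > 0"
    using assms(4) x(2) by (auto simp: F_def)
  have t: "0 \<le> t" "t \<le> 1" "t \<le> F x / (- F z)"
    unfolding t_def using Fz Fx by (simp_all add: frac_le del: divide_minus_right)
  have tF: "F x - t * (F x - F z) = 0"
    using Fz Fx by (simp add: t_def)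
  define y where "y = (1 - t) *\<^sub>R x + t *\<^sub>R z"
  show "\<exists>y\<in>P. a + v \<bullet> y \<le> 0 \<and> norm (x - y) \<le> diameter P / (- (a + v \<bullet> z)) * (a + v \<bullet> x)"
  proof (intro bexI conjI)
    show "y \<in> P"
      unfolding y_def using assms(1,3) x(1) t by (simp add: convexD)
    show "a + v \<bullet> y \<le> 0"
      using tF by (simp add: y_def F_def inner_add_right algebra_simps)
    have "x - y = t *\<^sub>R (x - z)"
      by (simp add: y_def algebra_simps)
    then have "norm (x - y) = t * norm (x - z)"
      using t by simp
    also have "\<dots> \<le> (F x / (- F z)) * diameter P"
      using t Fz Fx diameter_bounded_bound[OF assms(2) x(1) assms(3)]
      by (intro mult_mono) (auto simp: dist_norm)
    finally show "norm (x - y) \<le> diameter P / (- (a + v \<bullet> z)) * (a + v \<bullet> x)"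
      by (simp add: F_def mult.commute)
  qed
qed

text \<open>Finite generation is essential here: on a disk touching the line \<open>F = 0\<close>
  from the positive side, the distance to the contact point can grow like the square root of
  \<open>F\<close>.\<close>

lemma polytope_affine_error_bound_minimum:
  fixes P :: "'a::euclidean_space set"
  assumes "polytope P" "\<And>x. x \<in> P \<Longrightarrow> 0 \<le> a + v \<bullet> x" "z \<in> P" "a + v \<bullet> z = 0"
  obtains C where "\<And>x. x \<in> P \<Longrightarrow>
    \<exists>y\<in>P. a + v \<bullet> y \<le> 0 \<and> norm (x - y) \<le> C * (a + v \<bullet> x)"
proof -
  obtain W where W: "finite W" "P = convex hull W"
    using assms(1) unfolding polytope_def by blast
  have WP: "W \<subseteq> P"
    using W(2) hull_subset by metis
  have "convex P"
    using W by simp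
  \<comment> \<open>Each quotient is the constant that lets \<open>z\<close> serve as witness for
    the generator \<open>w\<close>; a sum of nonnegative terms dominates each of them. Generators
    with value 0 contribute 0, as division by zero gives 0, and are their own witnesses.\<close>
  define C where "C = (\<Sum>w\<in>W. norm (w - z) / (a + v \<bullet> w))"
  define G where "G = {x. \<exists>y\<in>P. a + v \<bullet> y \<le> 0 \<and> norm (x - y) \<le> C * (a + v \<bullet> x)}"
  have "W \<subseteq> G"
  proof
    fix w assume w: "w \<in> W"
    show "w \<in> G"
    proof (cases "a + v \<bullet> w = 0")
      case True
      then show ?thesis using w WP unfolding G_def by force
    next
      case False
      then have pos: "a + v \<bullet> w > 0"
        using assms(2) w WP by (metis subsetD order_le_less)
      have "norm (w - z) / (a + v \<bullet> w) \<le> C"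
        unfolding C_def using w W(1) WP assms(2)
        by (intro member_le_sum) (auto intro: divide_nonneg_nonneg)
      then have "norm (w - z) \<le> C * (a + v \<bullet> w)"
        using pos by (simp add: pos_divide_le_eq)
      then show ?thesis
        using assms(3,4) unfolding G_def by force
    qed
  qed
  \<comment> \<open>Witnesses are combined with the same weights as the points: the left side of the
    estimate is convex in the pair of point and witness, and the right side is affine in the
    point.\<close>
  moreover have "convex G"
  proof (rule convexI)
    fix x1 x2 and s t :: real
    assume st: "0 \<le> s" "0 \<le> t" "s + t = 1" and "x1 \<in> G" "x2 \<in> G"
    then obtain y1 y2 where y: "y1 \<in> P" "a + v \<bullet> y1 \<le> 0" "norm (x1 - y1) \<le> C * (a + v \<bullet> x1)"
      "y2 \<in> P" "a + v \<bullet> y2 \<le> 0" "norm (x2 - y2) \<le> C * (a + v \<bullet> x2)"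
      unfolding G_def by blast
    have comb: "a + v \<bullet> (s *\<^sub>R p + t *\<^sub>R q) = s * (a + v \<bullet> p) + t * (a + v \<bullet> q)" for p q
    proof -
      have "a = s * a + t * a"
        using st(3) by (metis distrib_right mult_1)
      then show ?thesis
        by (simp add: inner_add_right algebra_simps)
    qed
    let ?y = "s *\<^sub>R y1 + t *\<^sub>R y2"
    have "?y \<in> P"
      using \<open>convex P\<close> y st by (simp add: convexD)
    moreover have "a + v \<bullet> ?y \<le> 0"
      unfolding comb using y st by (simp add: add_nonpos_nonpos mult_nonneg_nonpos)
    moreover have "norm (s *\<^sub>R x1 + t *\<^sub>R x2 - ?y) \<le> C * (a + v \<bullet> (s *\<^sub>R x1 + t *\<^sub>R x2))"
    proof -
      have "norm (s *\<^sub>R x1 + t *\<^sub>R x2 - ?y) = norm (s *\<^sub>R (x1 - y1) + t *\<^sub>R (x2 - y2))"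
        by (simp add: algebra_simps)
      also have "\<dots> \<le> s * norm (x1 - y1) + t * norm (x2 - y2)"
        using norm_triangle_ineq[of "s *\<^sub>R (x1 - y1)" "t *\<^sub>R (x2 - y2)"] st by simp
      also have "\<dots> \<le> s * (C * (a + v \<bullet> x1)) + t * (C * (a + v \<bullet> x2))"
        using y st by (intro add_mono mult_left_mono) auto
      also have "\<dots> = C * (a + v \<bullet> (s *\<^sub>R x1 + t *\<^sub>R x2))"
        unfolding comb by (simp add: algebra_simps)
      finally show ?thesis .
    qed
    ultimately show "s *\<^sub>R x1 + t *\<^sub>R x2 \<in> G"
      unfolding G_def by blast
  qed
  ultimately have "P \<subseteq> G"
    unfolding W(2) by (rule hull_minimal)
  then show thesis
    by (intro that[of C]) (auto simp: G_def)
qed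

text \<open>The witness is sought in all of \<open>nonpos_set f\<close>, not in \<open>P\<close>,
  because a piece on which \<open>f\<close> is positive contains none. In the other two cases the
  witness lies in \<open>P\<close>, where \<open>f\<close> equals the affine function.\<close>

lemma polytope_piece_error_bound:
  fixes P :: "'a::euclidean_space set"
  assumes "polytope P" "\<And>x. x \<in> P \<Longrightarrow> f x = a + v \<bullet> x" "nonpos_set f \<noteq> {}"
  obtains C where "\<And>x. x \<in> P \<Longrightarrow> f x > 0 \<Longrightarrow> \<exists>y\<in>nonpos_set f. norm (x - y) \<le> C * f x"
proof -
  have P: "convex P" "compact P" "bounded P"
    using assms(1) polytope_imp_convex polytope_imp_compact polytope_imp_bounded by auto
  consider (neg) z where "z \<in> P" "a + v \<bullet> z < 0"
    | (min) z where "z \<in> P" "a + v \<bullet> z = 0" "\<And>x. x \<in> P \<Longrightarrow> 0 \<le> a + v \<bullet> x"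
    | (pos) "\<And>x. x \<in> P \<Longrightarrow> 0 < a + v \<bullet> x"
    by (metis less_linear not_less)
  then show thesis
  proof cases
    case neg
    obtain C where "\<And>x. x \<in> P \<Longrightarrow> a + v \<bullet> x > 0 \<Longrightarrow>
        \<exists>y\<in>P. a + v \<bullet> y \<le> 0 \<and> norm (x - y) \<le> C * (a + v \<bullet> x)"
      using convex_affine_error_bound_Slater[OF P(1,3) neg] by blast
    then show thesis
      using assms(2) by (intro that[of C]) (fastforce simp: nonpos_set_def)
  next
    case min
    obtain C where "\<And>x. x \<in> P \<Longrightarrow>
        \<exists>y\<in>P. a + v \<bullet> y \<le> 0 \<and> norm (x - y) \<le> C * (a + v \<bullet> x)"
      using polytope_affine_error_bound_minimum[OF assms(1) min(3,1,2)] by blast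
    then show thesis
      using assms(2) by (intro that[of C]) (fastforce simp: nonpos_set_def)
  next
    case pos
    obtain z where z: "z \<in> nonpos_set f"
      using assms(3) by blast
    show thesis
    \<comment> \<open>The empty polytope, which arises when the box misses a piece, also falls under
      \<open>pos\<close>; it has no minimum, but the claim is vacuous.\<close>
    proof (cases "P = {}")
      case False
      have "continuous_on P (\<lambda>x. a + v \<bullet> x)"
        by (intro continuous_intros)
      then obtain p where p: "p \<in> P" "\<And>x. x \<in> P \<Longrightarrow> a + v \<bullet> p \<le> a + v \<bullet> x"
        using continuous_attains_inf[OF P(2) False] by blast
      obtain B where B: "\<And>x. x \<in> P \<Longrightarrow> norm x \<le> B"
        using P(3) bounded_iff by blast
      define m where "m = a + v \<bullet> p"
      have m: "m > 0" "\<And>x. x \<in> P \<Longrightarrow> m \<le> f x"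
        using pos p assms(2) by (simp_all add: m_def)
      \<comment> \<open>The factor \<open>f x / m\<close> is at least 1, so it can be multiplied
        onto the uniform bound \<open>B + norm z\<close>.\<close>
      have "norm (x - z) \<le> (B + norm z) / m * f x" if "x \<in> P" for x
      proof -
        have le: "norm (x - z) \<le> B + norm z"
          using norm_triangle_ineq4[of x z] B[OF that] by simp
        then have "0 \<le> B + norm z"
          using norm_ge_zero order_trans by blast
        then have "(B + norm z) * m \<le> (B + norm z) * f x"
          using m(2)[OF that] by (intro mult_left_mono)
        then have "B + norm z \<le> (B + norm z) / m * f x"
          using m(1) by (simp add: pos_le_divide_eq)
        with le show ?thesis
          by (rule order_trans)
      qed
      then show thesis
        using z that by blast
    qed (use that in auto)
  qed
qed

lemma dist_to_set_le:
  assumes "is_norm N" "y \<in> Q"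
  shows "dist_to_set N x Q \<le> N (x - y)"
  unfolding dist_to_set_def using assms
  by (intro cINF_lower bdd_belowI2[where m = 0]) (auto simp: is_norm_def)

theorem theorem5:
  fixes N :: "real ^ 'd \<Rightarrow> real" and f :: "real ^ 'd \<Rightarrow> real"
  assumes "is_norm N"
    and "piecewise_affine f"
    and "nonpos_set f \<noteq> {}"
  shows "\<forall>V. norm_bounded N V \<longrightarrow>
    (\<exists>\<tau>>0. \<forall>x\<in>V. \<tau> * dist_to_set N x (nonpos_set f) \<le> max (f x) 0)"
proof (intro allI impI)
  fix V assume "norm_bounded N V"
  then obtain B where B: "\<And>x. x \<in> V \<Longrightarrow> N x \<le> B"
    unfolding norm_bounded_def by blast
  obtain K where K: "K > 0" "\<And>x. N x \<le> K * norm x"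
    using is_norm_le_norm[OF assms(1)] by blast
  obtain c where c: "c > 0" "\<And>x. c * norm x \<le> N x"
    using norm_le_is_norm[OF assms(1)] by blast
  have "norm x \<le> B / c" if "x \<in> V" for x
    using B[OF that] c(1) c(2)[of x] by (simp add: field_simps)
  then have "bounded V"
    unfolding bounded_iff by blast
  then obtain b where b: "V \<subseteq> cbox (- b) b"
    using bounded_subset_cbox_symmetric by blast
  obtain s :: nat and Q F where
    Q: "\<And>k. k \<in> {1..s} \<Longrightarrow> polyhedron (Q k)" and cover: "(\<Union>k\<in>{1..s}. Q k) = UNIV"
    and F: "\<And>k. k \<in> {1..s} \<Longrightarrow> affine_fun (F k)"
      "\<And>k x. k \<in> {1..s} \<Longrightarrow> x \<in> Q k \<Longrightarrow> f x = F k x"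
    using assms(2) unfolding piecewise_affine_def by (elim exE conjE) metis
  have "\<exists>C. \<forall>x \<in> Q k \<inter> cbox (- b) b. f x > 0 \<longrightarrow> (\<exists>y\<in>nonpos_set f. norm (x - y) \<le> C * f x)"
    if k: "k \<in> {1..s}" for k
  proof -
    obtain a v where av: "\<And>x. F k x = a + v \<bullet> x"
      using F(1)[OF k] unfolding affine_fun_def by blast
    have "polytope (Q k \<inter> cbox (- b) b)"
      unfolding polytope_eq_bounded_polyhedron using Q[OF k]
      by (auto intro!: polyhedron_Int polytope_imp_polyhedron polytope_interval bounded_Int)
    then show ?thesis
      using polytope_piece_error_bound[of "Q k \<inter> cbox (- b) b" f a v] assms(3) F(2)[OF k] av
      by (metis IntD1)
  qed
  then obtain C where C: "\<And>k x. k \<in> {1..s} \<Longrightarrow> x \<in> Q k \<inter> cbox (- b) b \<Longrightarrow> f x > 0 \<Longrightarrow>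
      \<exists>y\<in>nonpos_set f. norm (x - y) \<le> C k * f x"
    by metis
  \<comment> \<open>One constant for all pieces: absolute values guard against negative
    \<open>C k\<close>, \<open>K\<close> passes from the Euclidean norm to \<open>N\<close>, and the
    1 makes \<open>D\<close> positive, so that \<open>1 / D\<close> can serve as \<tau>.\<close>
  define D where "D = K * (\<Sum>k\<in>{1..s}. \<bar>C k\<bar>) + 1"
  have D: "D > 0"
    using K(1) by (simp add: D_def add_nonneg_pos sum_nonneg)
  have "dist_to_set N x (nonpos_set f) \<le> D * max (f x) 0" if x: "x \<in> V" for x
  proof (cases "f x > 0")
    case True
    obtain k where k: "k \<in> {1..s}" "x \<in> Q k"
      using cover by blast
    then obtain y where y: "y \<in> nonpos_set f" "norm (x - y) \<le> C k * f x"
      using C[of k x] True x b by blast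
    have "C k \<le> (\<Sum>k\<in>{1..s}. \<bar>C k\<bar>)"
      using member_le_sum[of k "{1..s}" "\<lambda>k. \<bar>C k\<bar>"] k(1) by simp
    then have "K * C k \<le> D"
      unfolding D_def using K(1) by (simp add: add_increasing2)
    have "dist_to_set N x (nonpos_set f) \<le> N (x - y)"
      using dist_to_set_le[OF assms(1) y(1)] .
    also have "\<dots> \<le> K * norm (x - y)"
      by (rule K(2))
    also have "\<dots> \<le> K * C k * f x"
      using y(2) K(1) by simp
    also have "\<dots> \<le> D * f x"
      using \<open>K * C k \<le> D\<close> True by (simp add: mult_right_mono)
    finally show ?thesis
      using True by simp
  next
    case False
    \<comment> \<open>Here \<open>x\<close> itself is a competitor in the infimum, so the distance
      is at most \<open>N 0 = 0\<close>.\<close>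
    then have "x \<in> nonpos_set f"
      by (simp add: nonpos_set_def)
    then have "dist_to_set N x (nonpos_set f) \<le> N (x - x)"
      by (rule dist_to_set_le[OF assms(1)])
    moreover have "N 0 = 0"
      using assms(1) unfolding is_norm_def by blast
    ultimately show ?thesis
      using False by simp
  qed
  then have "\<forall>x\<in>V. 1 / D * dist_to_set N x (nonpos_set f) \<le> max (f x) 0"
    using D by (simp add: field_simps)
  then show "\<exists>\<tau>>0. \<forall>x\<in>V. \<tau> * dist_to_set N x (nonpos_set f) \<le> max (f x) 0"
    using D by (intro exI[of _ "1 / D"]) simp
qed

end
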